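(* Let $\ell$ be a positive integer. For $n\ge1$ let $B_n^{(\ell)*}=\sum_{r=0}^{n}\binom{n+r}{2r}\frac{B_r^{(\ell)}}{n+r}$, where $\sum_{r\ge0}B_r^{(\ell)}\frac{z^r}{r!}=\left(\frac{z}{e^z-1}\right)^\ell$. Let $\rho_1(t)=\frac{\pi}{2}\operatorname{sech}^2(\pi t)$ and $\rho_\ell$ its $\ell$-fold convolution ($\rho_\ell(t)=\int_{-\infty}^\infty\rho_{\ell-1}(u)\rho_1(t-u)\,du$). Then the generating function $F_{B^*}(z;\ell)=\sum_{n=1}^\infty B_n^{(\ell)*}z^n$, viewed as a formal power series in $z$ (with the right-hand side understood through its expansion as $z\to0^+$), is given by $$F_{B^*}(z;\ell)=-\frac12\log z-\frac12\log\left|x-\frac{\ell}{2}\right|-\frac12\int_0^\infty\log(1+bu^2)\rho_\ell(u)\,du,$$ where $x=z+1/z+\ell-2$ and $b=(x-\ell/2)^{-2}$. *)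

theory Defs
  imports "HOL-Analysis.Analysis" "HOL-Computational_Algebra.Formal_Power_Series"
    "HOL-Library.Landau_Symbols"
begin

definition bernoulli_ho :: "nat \<Rightarrow> nat \<Rightarrow> real" where
  "bernoulli_ho l r = fact r * fps_nth ((fps_X / (fps_exp 1 - 1)) ^ l) r"

definition Bstar :: "nat \<Rightarrow> nat \<Rightarrow> real" where
  "Bstar l n = (\<Sum>r=0..n. real ((n + r) choose (2 * r)) * bernoulli_ho l r / real (n + r))"

text \<open>rho 1 t = (pi/2) sech^2 (pi t), and rho l is its l-fold convolution
  (rho 0 is unused and set to 0).\<close>
fun rho :: "nat \<Rightarrow> real \<Rightarrow> real" where
  "rho 0 t = 0"
| "rho (Suc 0) t = pi / 2 * (1 / cosh (pi * t)) ^ 2"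
| "rho (Suc (Suc l)) t = (LINT u|lborel. rho (Suc l) u * rho (Suc 0) (t - u))"

definition FB_rhs :: "nat \<Rightarrow> real \<Rightarrow> real" where
  "FB_rhs l z = (let x = z + 1 / z + real l - 2; b = 1 / (x - real l / 2) ^ 2 in
      - 1/2 * ln z - 1/2 * ln \<bar>x - real l / 2\<bar>
      - 1/2 * (LBINT u:{0..}. ln (1 + b * u ^ 2) * rho l u))"

end

theory Submission
  imports Defs
begin

text \<open>Let \<open>U\<close> be a random variable with density \<open>rho l\<close>. The density \<open>rho 1\<close> is logistic, so a Beta
  integral and Euler's reflection formula give its moment generating function
  \<open>(t/2) / sin (t/2)\<close>; consequently \<open>B = i U - l/2\<close> has the moments \<open>E B^r = bernoulli_ho l r\<close>.
  Replacing Bernoulli numbers by powers of \<open>B\<close> turns \<open>Bstar l n\<close> into \<open>T\<^sub>n(1 + B/2) / n\<close> with the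
  Chebyshev polynomials \<open>T\<^sub>n\<close>, whose generating function is \<open>- 1/2 log (1 - (2 + B) z + z\<^sup>2)\<close>, and
  the expectation of the real part of this logarithm is the closed form. For fixed \<open>U\<close> the Taylor
  remainder of order \<open>N\<close> is at most \<open>2 (|T\<^sub>N\<^sub>+\<^sub>1| + |T\<^sub>N|) z^(N+1)\<close>, uniformly in \<open>0 < z \<le> 1/4\<close>, and
  this bound has finite expectation.\<close>

section \<open>Chebyshev polynomials and the logarithm\<close>

text \<open>\<open>cheb n b\<close> is the Chebyshev polynomial \<open>T\<^sub>n(1 + b/2)\<close>; thanks to the truncated subtraction
  the formula also gives the correct value 1 for \<open>n = 0\<close>.\<close>

definition cheb :: "nat \<Rightarrow> complex \<Rightarrow> complex" where
  "cheb n b = (\<Sum>r\<le>n. of_nat (((n + r) choose (2 * r)) + ((n + r - 1) choose (2 * r))) / 2 * b ^ r)"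

text \<open>Pascal's rule applied twice: the second difference of a binomial coefficient in its
  upper index lowers the lower index by two. This is the source of the three-term recurrence
  below.\<close>

lemma binomial_second_difference:
  "(Suc (Suc m) choose Suc (Suc k)) + (m choose Suc (Suc k)) = 2 * (Suc m choose Suc (Suc k)) + (m choose k)"
  by simp

lemma cheb_0: "cheb 0 b = 1"
  by (simp add: cheb_def)

lemma cheb_1: "cheb (Suc 0) b = 1 + b / 2"
  by (simp add: cheb_def numeral_2_eq_2)

text \<open>For r > n the upper entries n + r and n + r - 1 lie below 2r, so the added terms vanish.
  Polynomials of different degree can then be compared over one range.\<close>

lemma cheb_upto:
  assumes "n \<le> m"
  shows "cheb n b = (\<Sum>r\<le>m. of_nat (((n + r) choose (2 * r)) + ((n + r - 1) choose (2 * r))) / 2 * b ^ r)"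
  unfolding cheb_def using assms
  by (intro sum.mono_neutral_left) (auto simp: binomial_eq_0)

text \<open>This is T_(n+2) = 2x T_(n+1) - T_n at x = 1 + b/2. On coefficients of
  \<open>b ^ Suc r\<close> it is the second-difference identity, applied to each of the two
  binomials.\<close>

lemma cheb_rec: "cheb (Suc (Suc n)) b = (2 + b) * cheb (Suc n) b - cheb n b"
proof -
  define a where "a n r = ((n + r) choose (2 * r)) + ((n + r - 1) choose (2 * r))" for n r :: nat
  have a_rec: "a (Suc (Suc n)) (Suc r) + a n (Suc r) = 2 * a (Suc n) (Suc r) + a (Suc n) r" for r
    using binomial_second_difference[of "n + r" "2 * r"] binomial_second_difference[of "Suc (n + r)" "2 * r"]
    unfolding a_def by (simp del: binomial_Suc_Suc)
  \<comment> \<open>The constant coefficient is 2/2 = 1 for every k, so it is split off and the rest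
    is indexed by \<open>Suc r\<close>, where \<open>a_rec\<close> applies.\<close>
  have up: "cheb k b = 1 + (\<Sum>r\<le>Suc n. of_nat (a k (Suc r)) / 2 * b ^ Suc r)" if "k \<le> Suc (Suc n)" for k
    unfolding cheb_upto[OF that] sum.atMost_Suc_shift[of _ "Suc n"] a_def by simp
  have up': "cheb (Suc n) b = (\<Sum>r\<le>Suc n. of_nat (a (Suc n) r) / 2 * b ^ r)"
    by (simp add: cheb_def a_def)
  have "cheb (Suc (Suc n)) b + cheb n b
      = 2 + (\<Sum>r\<le>Suc n. of_nat (a (Suc (Suc n)) (Suc r) + a n (Suc r)) / 2 * b ^ Suc r)"
    by (subst (1 2) up) (simp_all add: sum.distrib algebra_simps add_divide_distrib del: sum.atMost_Suc)
  also have "\<dots> = 2 * (1 + (\<Sum>r\<le>Suc n. of_nat (a (Suc n) (Suc r)) / 2 * b ^ Suc r))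
      + b * (\<Sum>r\<le>Suc n. of_nat (a (Suc n) r) / 2 * b ^ r)"
    unfolding a_rec
    by (simp add: sum.distrib algebra_simps add_divide_distrib sum_distrib_left del: sum.atMost_Suc)
  also have "\<dots> = (2 + b) * cheb (Suc n) b"
    by (subst (1) up[symmetric], simp, subst up'[symmetric], simp add: algebra_simps)
  finally show ?thesis by (simp add: algebra_simps)
qed

text \<open>Absorption gives (n+r) C(n+r-1, 2r) = (n-r) C(n+r, 2r), so the two binomials add up to
  2n/(n+r) C(n+r, 2r). The right-hand coefficients are those in \<open>Bstar\<close>.\<close>

lemma cheb_div:
  assumes "n \<ge> 1"
  shows "cheb n b / of_nat n = (\<Sum>r\<le>n. of_nat ((n + r) choose (2 * r)) / of_nat (n + r) * b ^ r)"
proof -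
  have "of_nat (((n + r) choose (2 * r)) + ((n + r - 1) choose (2 * r))) / 2 / of_nat n
      = (of_nat ((n + r) choose (2 * r)) / of_nat (n + r) :: complex)" if "r \<le> n" for r
  proof -
    obtain m where m: "n = Suc m" using assms by (cases n) auto
    have "(n + r) * ((n + r - 1) choose (2 * r)) = (n - r) * ((n + r) choose (2 * r))"
      using binomial_absorb_comp[of "n + r" "2 * r"] that by simp
    then have "(of_nat (n + r) :: complex) * of_nat ((n + r - 1) choose (2 * r))
        = (of_nat n - of_nat r) * of_nat ((n + r) choose (2 * r))"
      by (metis of_nat_diff of_nat_mult that)
    moreover have "(of_nat (n + r) :: complex) \<noteq> 0" "(of_nat n :: complex) \<noteq> 0"
      using assms by (auto simp del: of_nat_add)
    ultimately show ?thesis by (simp add: field_simps)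
  qed
  then have "of_nat (((n + r) choose (2 * r)) + ((n + r - 1) choose (2 * r))) / 2 * b ^ r / of_nat n
      = of_nat ((n + r) choose (2 * r)) / of_nat (n + r) * b ^ r" if "r \<le> n" for r
    using that by (metis times_divide_eq_left)
  then show ?thesis
    unfolding cheb_def sum_divide_distrib by (intro sum.cong) (auto simp del: of_nat_add)
qed

text \<open>The recurrence cancels all inner terms. The part 1 + b/2 - w is -1/2 times the
  derivative of the quadratic factor, so division by that factor yields the logarithmic derivative
  with an explicit remainder.\<close>

lemma cheb_telescope:
  "(1 - (2 + b) * w + w ^ 2) * (\<Sum>n<N. cheb (Suc n) b * w ^ n)
    = 1 + b / 2 - w - w ^ N * (cheb (Suc N) b - w * cheb N b)"
  by (induction N) (simp_all add: cheb_0 cheb_1 cheb_rec algebra_simps power2_eq_square)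

text \<open>The difference \<open>h\<close> vanishes at 0, and by \<open>cheb_telescope\<close> its
  derivative is the remainder divided by \<open>q\<close>. Since Re q >= 1/2, \<open>Ln\<close>
  stays off its branch cut and 1/|q| <= 2; the mean value inequality on the segment from 0 to z then
  gives the bound.\<close>

lemma cheb_log_remainder:
  fixes z :: real
  assumes z: "0 \<le> z" "z \<le> 1"
    and re: "\<And>t. 0 \<le> t \<Longrightarrow> t \<le> z \<Longrightarrow> Re (1 - (2 + b) * of_real t + of_real t ^ 2) \<ge> 1 / 2"
  shows "norm (- (1/2) * Ln (1 - (2 + b) * of_real z + of_real z ^ 2)
           - (\<Sum>n<N. cheb (Suc n) b / of_nat (Suc n) * of_real z ^ Suc n))
         \<le> 2 * (norm (cheb (Suc N) b) + norm (cheb N b)) * z ^ Suc N"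
proof -
  define q where "q w = 1 - (2 + b) * w + w ^ 2" for w
  define h where "h w = - (1/2) * Ln (q w) - (\<Sum>n<N. cheb (Suc n) b / of_nat (Suc n) * w ^ Suc n)" for w
  define h' where "h' w = w ^ N * (cheb (Suc N) b - w * cheb N b) / q w" for w
  define B where "B = 2 * (norm (cheb (Suc N) b) + norm (cheb N b)) * z ^ N"
  let ?S = "closed_segment 0 (of_real z :: complex)"
  have S: "\<exists>t. w = of_real t \<and> 0 \<le> t \<and> t \<le> z" if w: "w \<in> ?S" for w
  proof -
    from w obtain u where "0 \<le> u" "u \<le> 1" "w = of_real (u * z)"
      by (auto simp: closed_segment_def scaleR_conv_of_real)
    then show ?thesis using z by (intro exI[of _ "u * z"]) (auto simp: mult_left_le_one_le)
  qed
  have q: "Re (q w) \<ge> 1 / 2" if "w \<in> ?S" for w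
    using S[OF that] re unfolding q_def by blast
  have deriv: "(h has_field_derivative h' w) (at w within ?S)" if w: "w \<in> ?S" for w
  proof -
    have q0: "q w \<noteq> 0" "q w \<notin> \<real>\<^sub>\<le>\<^sub>0"
      using q[OF w] by (auto simp: complex_nonpos_Reals_iff)
    have dq: "(q has_field_derivative (2 * w - (2 + b))) (at w within ?S)"
      unfolding q_def by (auto intro!: derivative_eq_intros)
    have "(h has_field_derivative (- (1/2) * ((2 * w - (2 + b)) / q w) - (\<Sum>n<N. cheb (Suc n) b * w ^ n)))
        (at w within ?S)"
      unfolding h_def
    proof (intro DERIV_diff DERIV_sum DERIV_cmult)
      show "((\<lambda>w. Ln (q w)) has_field_derivative (2 * w - (2 + b)) / q w) (at w within ?S)"
        using q0 by (auto intro!: derivative_eq_intros dq simp: divide_inverse mult.commute)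
      fix n
      show "((\<lambda>w. cheb (Suc n) b / of_nat (Suc n) * w ^ Suc n) has_field_derivative cheb (Suc n) b * w ^ n)
          (at w within ?S)"
        by (auto intro!: derivative_eq_intros simp del: power_Suc of_nat_Suc)
    qed
    moreover have "- (1/2) * ((2 * w - (2 + b)) / q w) - (\<Sum>n<N. cheb (Suc n) b * w ^ n) = h' w"
    proof -
      have "(\<Sum>n<N. cheb (Suc n) b * w ^ n)
          = (1 + b / 2 - w - w ^ N * (cheb (Suc N) b - w * cheb N b)) / q w"
        using cheb_telescope[of b w N] q0(1) unfolding q_def[symmetric]
        by (simp add: eq_divide_eq mult.commute)
      then show ?thesis
        using q0(1) unfolding h'_def by (simp add: diff_divide_distrib add_divide_distrib)
    qed
    ultimately show ?thesis by simp
  qed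
  have bound: "norm (h' w) \<le> B" if w: "w \<in> ?S" for w
  proof -
    obtain t where t: "w = of_real t" "0 \<le> t" "t \<le> z" using S[OF w] by blast
    have "norm (q w) \<ge> 1 / 2"
      using q[OF w] complex_Re_le_cmod[of "q w"] by linarith
    then have "norm (h' w) \<le> norm (w ^ N * (cheb (Suc N) b - w * cheb N b)) / (1/2)"
      unfolding h'_def norm_divide by (intro divide_left_mono) auto
    also have "\<dots> = 2 * t ^ N * norm (cheb (Suc N) b - w * cheb N b)"
      using t by (simp add: norm_mult norm_power)
    also have "\<dots> \<le> 2 * z ^ N * (norm (cheb (Suc N) b) + norm (cheb N b))"
    proof (intro mult_mono power_mono)
      have "norm (w * cheb N b) \<le> norm (cheb N b)"
        using t z by (simp add: norm_mult mult_left_le_one_le)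
      then show "norm (cheb (Suc N) b - w * cheb N b) \<le> norm (cheb (Suc N) b) + norm (cheb N b)"
        using norm_triangle_ineq4[of "cheb (Suc N) b" "w * cheb N b"] by linarith
    qed (use t z in auto)
    finally show ?thesis by (simp add: B_def algebra_simps)
  qed
  have "norm (h (of_real z) - h 0) \<le> B * norm (of_real z - 0 :: complex)"
    by (rule field_differentiable_bound[where S = ?S]) (use deriv bound in auto)
  moreover have "h 0 = 0" by (simp add: h_def q_def)
  ultimately show ?thesis
    using z by (simp add: h_def q_def B_def mult_ac)
qed

section \<open>Moments of the logistic density\<close>

lemma Gamma_reflection_real:
  fixes x :: real
  shows "Gamma x * Gamma (1 - x) = pi / sin (pi * x)"
proof -
  have "Gamma (of_real x :: complex) * Gamma (of_real (1 - x)) = of_real pi / sin (of_real (pi * x))"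
    using Gamma_reflection_complex[of "of_real x"] by simp
  then show ?thesis
    unfolding Gamma_complex_of_real sin_of_real
    by (simp only: of_real_mult[symmetric] of_real_divide[symmetric] of_real_eq_iff)
qed

lemma Beta_reflection:
  fixes a :: real
  assumes "0 < a" "a < 1"
  shows "Beta (1 + a) (1 - a) = pi * a / sin (pi * a)"
proof -
  have "a \<notin> \<int>\<^sub>\<le>\<^sub>0" using assms by (auto elim!: nonpos_Ints_cases)
  then have "Beta (1 + a) (1 - a) = a * (Gamma a * Gamma (1 - a))"
    using Gamma_plus1[of a] by (simp add: Beta_def add.commute Gamma_numeral)
  then show ?thesis unfolding Gamma_reflection_real by simp
qed

text \<open>In this form the density is visibly the derivative of the logistic function e^(2 pi v) /
  (1 + e^(2 pi v)), the substitution used next.\<close>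

lemma rho_1_logistic: "rho (Suc 0) v = 2 * pi * exp (2 * pi * v) / (1 + exp (2 * pi * v))\<^sup>2"
proof -
  define e where "e = exp (pi * v)"
  have e: "e > 0" "exp (- (pi * v)) = 1 / e" "exp (2 * pi * v) = e\<^sup>2"
    by (simp_all add: e_def exp_minus divide_inverse mult.assoc flip: exp_double)
  have "cosh (pi * v) = (1 + e\<^sup>2) / (2 * e)"
    using e(1) unfolding cosh_def e(2) e_def[symmetric] by (simp add: field_simps power2_eq_square)
  then show ?thesis
    unfolding e(3) by (simp add: power_divide power_mult_distrib)
qed

text \<open>With x = p(v) the logistic function, x/(1-x) = e^(2 pi v), so e^(tv) = x^a (1-x)^(-a)
  for a = t/(2 pi). The integral becomes Beta(1+a, 1-a), and 0 < t < 2 pi means 0 < a < 1.\<close>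

lemma rho_1_mgf:
  assumes t: "0 < t" "t < 2 * pi"
  shows "has_bochner_integral lborel (\<lambda>v. exp (t * v) * rho (Suc 0) v) (t / 2 / sin (t / 2))"
proof -
  define a where "a = t / (2 * pi)"
  define p where "p v = exp (2 * pi * v) / (1 + exp (2 * pi * v))" for v :: real
  define f where "f x = x powr a * (1 - x) powr (- a)" for x :: real
  have a: "0 < a" "a < 1" using t by (auto simp: a_def field_simps)
  have pos: "1 + exp y \<noteq> 0" for y :: real
    using exp_gt_zero[of y] by linarith
  have deriv: "(p has_field_derivative rho (Suc 0) v) (at v within UNIV)" for v
    unfolding p_def rho_1_logistic using pos
    by (auto intro!: derivative_eq_intros simp: power2_eq_square field_simps)
  have range: "p ` UNIV = {0<..<1}"
  proof (intro equalityI subsetI)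
    fix x assume "x \<in> p ` UNIV" then show "x \<in> {0<..<1}"
      by (auto simp: p_def field_simps add_pos_pos)
  next
    fix x :: real assume x: "x \<in> {0<..<1}"
    then have "p (ln (x / (1 - x)) / (2 * pi)) = x"
      by (simp add: p_def field_simps)
    then show "x \<in> p ` UNIV" by (metis rangeI)
  qed
  have inj: "inj_on p UNIV"
  proof (rule injI)
    fix u v assume "p u = p v"
    then have "exp (2 * pi * u) = exp (2 * pi * v)"
      using pos by (simp add: p_def field_simps)
    then show "u = v" by simp
  qed
  have "(f has_integral Beta (1 + a) (1 - a)) {0<..<1}"
    using has_integral_Beta_real[of "1 + a" "1 - a"] a
    by (simp add: f_def[abs_def] has_integral_Icc_iff_Ioo)
  then have "f absolutely_integrable_on p ` UNIV \<and> integral (p ` UNIV) f = Beta (1 + a) (1 - a)"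
    unfolding range
    by (auto simp: f_def has_integral_iff intro!: nonnegative_absolutely_integrable_1)
  then have *: "(\<lambda>v. \<bar>rho (Suc 0) v\<bar> * f (p v)) absolutely_integrable_on UNIV"
      "integral UNIV (\<lambda>v. \<bar>rho (Suc 0) v\<bar> * f (p v)) = Beta (1 + a) (1 - a)"
    using has_absolute_integral_change_of_variables_1'[of UNIV p "rho (Suc 0)" f, OF _ deriv inj] by auto
  have eq: "\<bar>rho (Suc 0) v\<bar> * f (p v) = exp (t * v) * rho (Suc 0) v" for v
  proof -
    have "1 - p v = 1 / (1 + exp (2 * pi * v))" using pos by (simp add: p_def field_simps)
    then have "f (p v) = exp (2 * pi * v) powr a"
      using pos[of "2 * pi * v"] by (simp add: f_def p_def powr_divide powr_minus add_pos_pos less_imp_le)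
    also have "\<dots> = exp (t * v)" by (simp add: powr_def a_def)
    finally show ?thesis by (simp add: rho_1_logistic)
  qed
  \<comment> \<open>Borel measurability carries integrability from the completed Lebesgue measure
    over to \<open>lborel\<close>.\<close>
  have "(\<lambda>v. exp (t * v) * rho (Suc 0) v) \<in> borel_measurable borel"
    unfolding rho_1_logistic by measurable
  then have int: "integrable lborel (\<lambda>v. exp (t * v) * rho (Suc 0) v)"
    using *(1) unfolding eq set_integrable_def by (simp add: integrable_completion)
  then have "integral\<^sup>L lborel (\<lambda>v. exp (t * v) * rho (Suc 0) v) = Beta (1 + a) (1 - a)"
    using *(2) unfolding eq integral_lborel[OF int] by (simp del: rho.simps)
  also have "\<dots> = t / 2 / sin (t / 2)"
    unfolding Beta_reflection[OF a] by (simp add: a_def)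
  finally show ?thesis using int by (simp add: has_bochner_integral_iff)
qed

text \<open>Dividing a nonzero series by its lowest power of X leaves a nonzero constant term, hence
  nonzero values near 0. This lifts identities known only for small real t > 0 to formal power
  series.\<close>

lemma fps_eq_0_if_eval_real:
  fixes F :: "complex fps"
  assumes r: "fps_conv_radius F > 0"
    and ev: "eventually (\<lambda>t::real. eval_fps F (of_real t) = 0) (at_right 0)"
  shows "F = 0"
proof (rule ccontr)
  assume "F \<noteq> 0"
  define G where "G = fps_shift (subdegree F) F"
  have F: "F = G * fps_X ^ subdegree F"
    by (simp add: G_def subdegree_decompose[symmetric])
  have G: "fps_conv_radius G > 0" using r by (simp add: G_def)
  have "continuous (at 0) (eval_fps G)"
    using G by (intro has_fps_expansion_imp_continuous[of _ G] eval_fps_has_fps_expansion) 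
  then have "(eval_fps G \<longlongrightarrow> fps_nth G 0) (nhds 0)"
    by (metis continuous_at_imp_continuous_within eval_fps_at_0 isCont_def tendsto_at_iff_tendsto_nhds)
  then have "((\<lambda>t. eval_fps G (of_real t)) \<longlongrightarrow> fps_nth G 0) (at_right 0)"
    by (rule filterlim_compose) (auto intro!: tendsto_eq_intros)
  moreover have "fps_nth G 0 \<noteq> 0" using \<open>F \<noteq> 0\<close> by (simp add: G_def)
  ultimately have "eventually (\<lambda>t. eval_fps G (of_real t) \<noteq> 0) (at_right (0::real))"
    by (rule tendsto_imp_eventually_ne)
  moreover have "eventually (\<lambda>t. ereal (norm (of_real t :: complex)) < fps_conv_radius G) (at_right (0::real))"
  proof -
    obtain e :: real where e: "0 < ereal e" "ereal e < fps_conv_radius G"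
      using ereal_dense2[OF G] by blast
    show ?thesis
      using eventually_at_right_real[of 0 e] e
      by (auto elim!: eventually_mono intro: le_less_trans[of _ "ereal e"])
  qed
  moreover have "eventually (\<lambda>t. t > (0::real)) (at_right 0)"
    by (rule eventually_at_right_less)
  ultimately have "eventually (\<lambda>t::real. False) (at_right 0)"
    using ev
  proof eventually_elim
    case (elim t)
    then show ?case by (subst (asm) F) (simp add: eval_fps_mult)
  qed
  then show False by simp
qed

text \<open>Termwise integration of the exponential series, with majorant e^v + e^(-v) >= e^|v|
  independent of the number of terms.\<close>

lemma rho_1_exp_series:
  fixes m :: "nat \<Rightarrow> real"
  defines "m \<equiv> \<lambda>k. LINT v|lborel. v ^ k * rho (Suc 0) v"
  shows "integrable lborel (\<lambda>v. v ^ k * rho (Suc 0) v)"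
    and "\<bar>t\<bar> \<le> 1 \<Longrightarrow> (\<lambda>k. m k / fact k * t ^ k) sums (LINT v|lborel. exp (t * v) * rho (Suc 0) v)"
proof -
  let ?r = "rho (Suc 0)"
  have [measurable]: "?r \<in> borel_measurable borel"
    unfolding rho_1_logistic by measurable
  have nonneg: "?r v \<ge> 0" for v by simp
  \<comment> \<open>The rate 1 lies below 2 pi; since \<open>rho (Suc 0)\<close> is even, reflection
    supplies the other exponential.\<close>
  have "integrable lborel (\<lambda>v. exp v * ?r v)"
    using rho_1_mgf[of 1] pi_gt3 by (simp add: has_bochner_integral_iff del: rho.simps)
  moreover from this have "integrable lborel (\<lambda>v. exp (- v) * ?r v)"
    by (subst lborel_integrable_real_affine_iff[where c = "-1" and t = 0, symmetric]) simp_all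
  ultimately have "integrable lborel (\<lambda>v. exp v * ?r v + exp (- v) * ?r v)"
    by (rule Bochner_Integration.integrable_add)
  then have int: "integrable lborel (\<lambda>v. (exp v + exp (- v)) * ?r v)"
    by (simp only: distrib_right)
  have partial: "(\<Sum>k<n. \<bar>v\<bar> ^ k / fact k) \<le> exp v + exp (- v)" for n and v :: real
  proof -
    have "(\<Sum>k<n. \<bar>v\<bar> ^ k / fact k) \<le> exp \<bar>v\<bar>"
      using sum_le_suminf[OF summable_exp_generic[of "\<bar>v\<bar>"], of "{..<n}"]
      by (simp add: exp_def divide_inverse mult.commute)
    also have "\<dots> \<le> exp v + exp (- v)" by (simp add: abs_if)
    finally show ?thesis .
  qed
  have term_int: "integrable lborel (\<lambda>v. \<bar>v\<bar> ^ k / fact k * ?r v)" for k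
  proof (rule Bochner_Integration.integrable_bound[OF int])
    show "AE v in lborel. norm (\<bar>v\<bar> ^ k / fact k * ?r v) \<le> norm ((exp v + exp (- v)) * ?r v)"
    proof (rule AE_I2)
      fix v :: real
      have "\<bar>v\<bar> ^ k / fact k \<le> (\<Sum>j<Suc k. \<bar>v\<bar> ^ j / fact j)"
        by (rule member_le_sum) auto
      also have "\<dots> \<le> exp v + exp (- v)" by (rule partial)
      finally have "\<bar>v\<bar> ^ k / fact k * ?r v \<le> (exp v + exp (- v)) * ?r v"
        by (rule mult_right_mono[OF _ nonneg])
      moreover have "0 \<le> \<bar>v\<bar> ^ k / fact k * ?r v"
        by (intro mult_nonneg_nonneg nonneg) simp
      ultimately show "norm (\<bar>v\<bar> ^ k / fact k * ?r v) \<le> norm ((exp v + exp (- v)) * ?r v)"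
        unfolding real_norm_def by linarith
    qed
  qed measurable
  show mom_int: "integrable lborel (\<lambda>v. v ^ k * ?r v)" for k
    by (rule Bochner_Integration.integrable_bound[OF integrable_mult_right[OF term_int[of k], of "fact k"]])
      (auto simp: abs_mult power_abs simp del: rho.simps)
  assume t: "\<bar>t\<bar> \<le> 1"
  let ?f = "\<lambda>k v. v ^ k * ?r v * (t ^ k / fact k)"
  have f_int: "integrable lborel (?f k)" for k
    by (rule integrable_mult_left) (use mom_int in blast)
  have f_sums: "(\<lambda>k. ?f k v) sums (exp (t * v) * ?r v)" for v
    using sums_mult2[OF exp_converges[of "t * v"], of "?r v"]
    by (simp add: power_mult_distrib divide_inverse mult_ac del: rho.simps)
  have f_le: "norm (?f k v) \<le> \<bar>v\<bar> ^ k / fact k * ?r v" for k v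
  proof -
    have "norm (?f k v) = \<bar>v\<bar> ^ k / fact k * ?r v * \<bar>t\<bar> ^ k"
      using nonneg[of v] by (simp add: abs_mult power_abs del: rho.simps)
    also have "\<dots> \<le> \<bar>v\<bar> ^ k / fact k * ?r v"
      using t nonneg[of v] by (intro mult_left_le power_le_one mult_nonneg_nonneg) auto
    finally show ?thesis .
  qed
  \<comment> \<open>Bounded partial sums of the integrated norms justify exchanging sum and
    integral.\<close>
  have "summable (\<lambda>k. LINT v|lborel. norm (?f k v))"
  proof (rule bounded_imp_summable)
    fix n
    have "(\<Sum>k\<le>n. LINT v|lborel. norm (?f k v)) = (LINT v|lborel. (\<Sum>k\<le>n. norm (?f k v)))"
      by (intro Bochner_Integration.integral_sum[symmetric] integrable_norm f_int)
    also have "\<dots> \<le> (LINT v|lborel. (exp v + exp (- v)) * ?r v)"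
    proof (rule integral_mono)
      fix v
      have "(\<Sum>k\<le>n. norm (?f k v)) \<le> (\<Sum>k<Suc n. \<bar>v\<bar> ^ k / fact k) * ?r v"
        unfolding sum_distrib_right lessThan_Suc_atMost by (intro sum_mono f_le)
      also have "\<dots> \<le> (exp v + exp (- v)) * ?r v"
        by (intro mult_right_mono partial nonneg)
      finally show "(\<Sum>k\<le>n. norm (?f k v)) \<le> (exp v + exp (- v)) * ?r v" .
    qed (intro Bochner_Integration.integrable_sum integrable_norm f_int int)+
    finally show "(\<Sum>k\<le>n. LINT v|lborel. norm (?f k v)) \<le> (LINT v|lborel. (exp v + exp (- v)) * ?r v)" .
  qed simp
  moreover have "AE v in lborel. summable (\<lambda>k. norm (?f k v))"
  proof (rule AE_I2)
    fix v
    have "summable (\<lambda>k. \<bar>v\<bar> ^ k / fact k * ?r v)"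
      using summable_mult2[OF summable_exp_generic[of "\<bar>v\<bar>"], of "?r v"]
      by (simp add: divide_inverse mult.commute del: rho.simps)
    then show "summable (\<lambda>k. norm (?f k v))"
      by (rule summable_comparison_test') (use f_le in simp)
  qed
  ultimately have "(\<lambda>k. integral\<^sup>L lborel (?f k)) sums (LINT v|lborel. (\<Sum>k. ?f k v))"
    by (intro sums_integral f_int)
  then show "(\<lambda>k. m k / fact k * t ^ k) sums (LINT v|lborel. exp (t * v) * ?r v)"
    unfolding sums_unique[OF f_sums, symmetric] m_def integral_mult_left_zero
    by (simp del: rho.simps)
qed

section \<open>Bernoulli numbers of order one as logistic moments\<close>

lemma bernoulli_fps_mult: "fps_X / (fps_exp 1 - 1) * (fps_exp 1 - 1) = (fps_X :: real fps)"
proof (rule dvd_div_mult_self)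
  let ?E = "fps_exp 1 - 1 :: real fps"
  have E1: "fps_nth ?E 1 = 1" "fps_nth ?E 0 = 0" by simp_all
  \<comment> \<open>The order of vanishing equals that of X, which makes the formal quotient
    exact.\<close>
  have "subdegree ?E = 1"
    by (rule subdegreeI) (use E1 in auto)
  moreover have "?E \<noteq> 0" using E1 by force
  ultimately show "?E dvd fps_X"
    by (subst fps_dvd_iff) auto
qed

text \<open>The defining equation has only one solution, because power series over a field can be
  cancelled; the coefficientwise embedding of the real quotient is that solution.\<close>

lemma bernoulli_fps_complex:
  fixes A :: "complex fps"
  assumes "A * (fps_exp 1 - 1) = fps_X"
  shows "fact k * fps_nth A k = of_real (bernoulli_ho (Suc 0) k)"
proof -
  let ?E = "fps_exp 1 - 1 :: real fps" and ?B = "fps_X / (fps_exp 1 - 1) :: real fps"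
  let ?Bc = "Abs_fps (\<lambda>n. of_real (fps_nth ?B n)) :: complex fps"
  have "fps_nth (?B * ?E) n = (if n = 1 then 1 else 0)" for n
    unfolding bernoulli_fps_mult by simp
  then have "of_real (fps_nth (?B * ?E) n) = (if n = 1 then 1 else 0 :: complex)" for n
    by (metis of_real_0 of_real_1)
  moreover have "fps_nth (?Bc * (fps_exp 1 - 1)) n = of_real (fps_nth (?B * ?E) n)" for n
    by (auto simp: fps_mult_nth intro!: sum.cong)
  ultimately have "?Bc * (fps_exp 1 - 1) = fps_X"
    by (intro fps_ext) simp
  moreover have "fps_exp 1 - 1 \<noteq> (0 :: complex fps)"
  proof
    assume "fps_exp 1 - 1 = (0 :: complex fps)"
    then have "fps_nth (fps_exp 1 - 1 :: complex fps) 1 = 0" by simp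
    then show False by simp
  qed
  ultimately have "A = ?Bc" using assms by (metis mult_right_cancel)
  then show ?thesis by (simp add: bernoulli_ho_def)
qed

text \<open>On the imaginary axis the moment generating function \<open>(t/2) / sin (t/2)\<close> becomes
  \<open>(s/2) / sinh (s/2)\<close>, and \<open>exp (- s/2) (s/2) / sinh (s/2) = s / (exp s - 1)\<close>.\<close>

lemma rho_1_moments:
  "has_bochner_integral lborel (\<lambda>u. (\<i> * of_real u - 1 / 2) ^ k * of_real (rho (Suc 0) u))
      (of_real (bernoulli_ho (Suc 0) k))"
proof -
  define m where "m k = (LINT v|lborel. v ^ k * rho (Suc 0) v)" for k
  define M :: "complex fps" where "M = Abs_fps (\<lambda>k. of_real (m k / fact k))"
  define iX :: "complex fps" where "iX = fps_const \<i> * fps_X"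
  have sums: "(\<lambda>k. fps_nth M k * of_real t ^ k) sums of_real (LINT v|lborel. exp (t * v) * rho (Suc 0) v)"
    if "\<bar>t\<bar> \<le> 1" for t
    using rho_1_exp_series(2)[OF that] unfolding m_def[symmetric] M_def fps_nth_Abs_fps
    by (simp only: of_real_mult[symmetric] of_real_power[symmetric] sums_of_real_iff)
  have rad: "fps_conv_radius M > 0"
  proof -
    have "ereal (norm (1 :: complex)) \<le> fps_conv_radius M"
      unfolding fps_conv_radius_def
      by (rule conv_radius_geI) (use sums_summable[OF sums[of 1]] in simp)
    then show ?thesis by (rule less_le_trans[rotated]) simp
  qed
  \<comment> \<open>Clearing the denominator turns (t/2) / sin (t/2) into an identity of power
    series, which needs checking only for small t > 0.\<close>
  have "M * fps_sin (1 / 2) - fps_const (1 / 2) * fps_X = 0" (is "?F = 0")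
  proof (rule fps_eq_0_if_eval_real)
    have F: "(\<lambda>z. eval_fps M z * sin (1 / 2 * z) - 1 / 2 * z) has_fps_expansion ?F"
      by (intro fps_expansion_intros eval_fps_has_fps_expansion rad)
    then show "fps_conv_radius ?F > 0" by (simp add: has_fps_expansion_def)
    have "eventually (\<lambda>z. eval_fps ?F z = eval_fps M z * sin (1 / 2 * z) - 1 / 2 * z) (nhds 0)"
      using F unfolding has_fps_expansion_def by (simp add: eq_commute)
    moreover have "filterlim (\<lambda>t::real. of_real t :: complex) (nhds 0) (at_right 0)"
      by (auto intro!: tendsto_eq_intros)
    ultimately have "eventually (\<lambda>t::real. eval_fps ?F (of_real t)
        = eval_fps M (of_real t) * sin (1 / 2 * of_real t) - 1 / 2 * of_real t) (at_right 0)"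
      by (rule eventually_compose_filterlim)
    moreover have "eventually (\<lambda>t. t \<in> {0<..<1::real}) (at_right 0)"
      by (rule eventually_at_right_real) simp
    ultimately show "eventually (\<lambda>t::real. eval_fps ?F (of_real t) = 0) (at_right 0)"
    proof eventually_elim
      case (elim t)
      have "eval_fps M (of_real t) = of_real (t / 2 / sin (t / 2))"
        unfolding eval_fps_def
        using sums_unique[OF sums[of t]] rho_1_mgf[of t] elim(2) pi_gt3
        by (simp add: has_bochner_integral_iff del: rho.simps)
      moreover have "sin (1 / 2 * of_real t :: complex) = of_real (sin (t / 2))"
        by (simp add: sin_of_real[symmetric])
      moreover have "sin (t / 2) \<noteq> 0"
        using sin_gt_zero[of "t / 2"] elim(2) pi_gt3 by auto
      ultimately show ?case unfolding elim(1) by simp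
    qed
  qed
  \<comment> \<open>Replacing X by iX passes from moments of U to moments of i U and turns the sine
    into a difference of exponentials.\<close>
  then have "(M * fps_sin (1 / 2)) oo iX = (fps_const (1 / 2) * fps_X) oo iX" by simp
  then have C: "(M oo iX) * (fps_sin (1 / 2) oo iX) = fps_const (1 / 2) * iX"
    by (simp add: fps_compose_mult_distrib iX_def)
  have "fps_const (2 * \<i>) * fps_sin (1 / 2) = fps_exp (\<i> / 2) - fps_exp (- \<i> / 2)"
    by (subst fps_sin_fps_exp_ii) simp
  then have "(fps_const (2 * \<i>) * fps_sin (1 / 2)) oo iX = (fps_exp (\<i> / 2) - fps_exp (- \<i> / 2)) oo iX" by simp
  then have S: "fps_const (2 * \<i>) * (fps_sin (1 / 2) oo iX) = fps_exp (- 1 / 2) - fps_exp (1 / 2)"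
    by (simp add: fps_compose_mult_distrib fps_compose_sub_distrib iX_def)
  have "(M oo iX) * (fps_exp (1 / 2) - fps_exp (- 1 / 2)) = - (fps_const (2 * \<i>) * ((M oo iX) * (fps_sin (1 / 2) oo iX)))"
    unfolding mult.left_commute[of "fps_const (2 * \<i>)"] S by (simp add: algebra_simps)
  also have "\<dots> = fps_X"
    unfolding C by (simp add: iX_def mult.assoc[symmetric])
  \<comment> \<open>The factor \<open>fps_exp (- 1 / 2)\<close> encodes the shift by -1/2, so the
    product with \<open>M oo iX\<close> is the exponential generating function of the moments of i U
    - 1/2.\<close>
  finally have "(fps_exp (- 1 / 2) * (M oo iX)) * (fps_exp 1 - 1) = fps_X"
    by (simp add: algebra_simps fps_exp_add_mult[symmetric])
  from bernoulli_fps_complex[OF this, of k]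
  have B: "of_real (bernoulli_ho (Suc 0) k) = fact k * (\<Sum>j\<le>k. (- 1 / 2) ^ j / fact j * (\<i> ^ (k - j) * of_real (m (k - j) / fact (k - j))))"
    by (simp add: fps_mult_nth M_def iX_def atLeast0AtMost)
  have mom: "has_bochner_integral lborel (\<lambda>v. of_real (v ^ j * rho (Suc 0) v)) (of_real (m j) :: complex)" for j
    unfolding m_def by (intro has_bochner_integral_of_real has_bochner_integral_integrable rho_1_exp_series)
  have "has_bochner_integral lborel
      (\<lambda>v. \<Sum>j\<le>k. of_nat (k choose j) * (- 1 / 2) ^ j * \<i> ^ (k - j) * of_real (v ^ (k - j) * rho (Suc 0) v))
      (\<Sum>j\<le>k. of_nat (k choose j) * (- 1 / 2) ^ j * \<i> ^ (k - j) * of_real (m (k - j)))"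
    by (intro has_bochner_integral_sum has_bochner_integral_mult_right mom)
  moreover have "(\<Sum>j\<le>k. of_nat (k choose j) * (- 1 / 2) ^ j * \<i> ^ (k - j) * of_real (v ^ (k - j) * rho (Suc 0) v))
      = (\<i> * of_real v - 1 / 2) ^ k * of_real (rho (Suc 0) v)" for v
    using binomial_ring[of "- 1 / 2 :: complex" "\<i> * of_real v" k]
    by (simp add: sum_distrib_right sum_distrib_left power_mult_distrib mult_ac del: rho.simps)
  moreover have "(\<Sum>j\<le>k. of_nat (k choose j) * (- 1 / 2) ^ j * \<i> ^ (k - j) * of_real (m (k - j)))
      = of_real (bernoulli_ho (Suc 0) k)"
    unfolding B sum_distrib_left
    by (intro sum.cong refl) (simp add: binomial_fact)
  ultimately show ?thesis by (simp only:)
qed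

section \<open>Convolution powers\<close>

lemma integrable_pair_mult:
  fixes f g :: "real \<Rightarrow> complex"
  assumes f: "integrable lborel f" and g: "integrable lborel g"
  shows "integrable (lborel \<Otimes>\<^sub>M lborel) (\<lambda>(u, v). f u * g v)"
    and "(\<integral>p. (case p of (u, v) \<Rightarrow> f u * g v) \<partial>(lborel \<Otimes>\<^sub>M lborel)) = integral\<^sup>L lborel f * integral\<^sup>L lborel g"
proof -
  have [measurable]: "f \<in> borel_measurable borel" "g \<in> borel_measurable borel"
    using f g by auto
  show int: "integrable (lborel \<Otimes>\<^sub>M lborel) (\<lambda>(u, v). f u * g v)"
    by (rule lborel_pair.Fubini_integrable) (use f g in \<open>auto simp: norm_mult\<close>)
  show "(\<integral>p. (case p of (u, v) \<Rightarrow> f u * g v) \<partial>(lborel \<Otimes>\<^sub>M lborel)) = integral\<^sup>L lborel f * integral\<^sup>L lborel g"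
    by (subst lborel_pair.integral_fst'[symmetric, OF int]) simp
qed

text \<open>Fubini after the shear t = u + v: the law of a sum of independent variables is the
  convolution. Translation invariance moves integrability from \<open>?F\<close> to
  \<open>?G\<close>.\<close>

lemma integral_convolution:
  fixes f g :: "real \<Rightarrow> real" and h :: "real \<Rightarrow> complex"
  assumes [measurable]: "f \<in> borel_measurable borel" "g \<in> borel_measurable borel" "h \<in> borel_measurable borel"
    and int: "integrable (lborel \<Otimes>\<^sub>M lborel) (\<lambda>(u, v). h (u + v) * of_real (f u * g v))"
  shows "has_bochner_integral lborel (\<lambda>t. h t * of_real (LINT u|lborel. f u * g (t - u)))
    (\<integral>p. (case p of (u, v) \<Rightarrow> h (u + v) * of_real (f u * g v)) \<partial>(lborel \<Otimes>\<^sub>M lborel))"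
proof -
  let ?F = "\<lambda>(u, v). h (u + v) * of_real (f u * g v) :: complex"
  let ?G = "\<lambda>(u, t). h t * of_real (f u * g (t - u)) :: complex"
  have shift: "(\<lambda>v. ?G (u, u + 1 * v)) = (\<lambda>v. ?F (u, v))" for u by auto
  have G: "integrable (lborel \<Otimes>\<^sub>M lborel) ?G"
  proof (rule lborel_pair.Fubini_integrable)
    show "integrable lborel (\<lambda>u. LINT t|lborel. norm (?G (u, t)))"
    proof -
      have "(LINT t|lborel. norm (?G (u, t))) = (LINT t|lborel. norm (?F (u, t)))" for u
        by (subst lborel_integral_real_affine[where c = 1 and t = u]) auto
      then show ?thesis
        using lborel_pair.integrable_fst'[OF integrable_norm[OF int]] by simp
    qed
    show "AE u in lborel. integrable lborel (\<lambda>t. ?G (u, t))"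
      using lborel_pair.AE_integrable_fst'[OF int]
    proof eventually_elim
      case (elim u)
      then show ?case
        by (subst lborel_integrable_real_affine_iff[where c = 1 and t = u, symmetric]) auto
    qed
  qed measurable
  have inner: "(LINT u|lborel. h t * of_real (f u * g (t - u))) = h t * of_real (LINT u|lborel. f u * g (t - u))" for t
    by (simp del: of_real_mult)
  have "(\<integral>p. ?G p \<partial>(lborel \<Otimes>\<^sub>M lborel)) = (\<integral>p. ?F p \<partial>(lborel \<Otimes>\<^sub>M lborel))"
  proof -
    have "(LINT t|lborel. ?G (u, t)) = (LINT t|lborel. ?F (u, t))" for u
      by (subst lborel_integral_real_affine[where c = 1 and t = u]) auto
    then show ?thesis
      by (simp only: lborel_pair.integral_fst'[symmetric, OF G] lborel_pair.integral_fst'[symmetric, OF int])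
  qed
  then show ?thesis
    using lborel_pair.integrable_snd[OF G] lborel_pair.integral_snd[OF G]
    unfolding inner by (simp add: has_bochner_integral_iff)
qed

text \<open>The Cauchy product of exponential generating functions, matching the binomial expansion
  of moments of an independent sum.\<close>

lemma bernoulli_ho_Suc:
  "bernoulli_ho (Suc l) k = (\<Sum>j\<le>k. real (k choose j) * bernoulli_ho l j * bernoulli_ho 1 (k - j))"
proof -
  let ?B = "fps_X / (fps_exp 1 - 1) :: real fps"
  have "bernoulli_ho (Suc l) k = fact k * fps_nth (?B ^ l * ?B) k"
    by (simp add: bernoulli_ho_def power_Suc2 del: power_Suc)
  also have "\<dots> = (\<Sum>j\<le>k. fact k * fps_nth (?B ^ l) j * fps_nth ?B (k - j))"
    by (simp only: fps_mult_nth sum_distrib_left mult.assoc atLeast0AtMost)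
  also have "\<dots> = (\<Sum>j\<le>k. real (k choose j) * bernoulli_ho l j * bernoulli_ho 1 (k - j))"
    by (intro sum.cong refl) (simp add: bernoulli_ho_def binomial_fact)
  finally show ?thesis .
qed

text \<open>If \<open>U\<close> has density \<open>rho l\<close>, the umbra \<open>i U - l/2\<close> represents the Bernoulli numbers of
  order \<open>l\<close>: convolving the densities adds independent umbrae, as multiplying the generating
  functions does.\<close>

lemma rho_moments:
  "has_bochner_integral lborel (\<lambda>u. (\<i> * of_real u - of_nat (Suc l) / 2) ^ k * of_real (rho (Suc l) u))
    (of_real (bernoulli_ho (Suc l) k))"
proof (induction l arbitrary: k)
  case 0
  show ?case using rho_1_moments[of k] by (simp del: rho.simps)
next
  case (Suc l)
  let ?f = "\<lambda>j u. (\<i> * of_real u - of_nat (Suc l) / 2) ^ j * of_real (rho (Suc l) u) :: complex"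
  let ?g = "\<lambda>j u. (\<i> * of_real u - 1 / 2) ^ j * of_real (rho (Suc 0) u) :: complex"
  have f: "integrable lborel (?f j)" "integral\<^sup>L lborel (?f j) = of_real (bernoulli_ho (Suc l) j)" for j
    using Suc[of j] by (auto simp: has_bochner_integral_iff)
  have g: "integrable lborel (?g j)" "integral\<^sup>L lborel (?g j) = of_real (bernoulli_ho 1 j)" for j
    using rho_1_moments[of j] by (auto simp: has_bochner_integral_iff)
  \<comment> \<open>Measurability of the densities is read off the zeroth moment, where the power
    factor is 1.\<close>
  have meas: "rho (Suc l) \<in> borel_measurable borel" "rho (Suc 0) \<in> borel_measurable borel"
    using borel_measurable_integrable[OF f(1)[of 0]] borel_measurable_integrable[OF g(1)[of 0]]
    by (simp_all add: borel_measurable_complex_iff del: rho.simps)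
  let ?h = "\<lambda>t. (\<i> * of_real t - of_nat (Suc (Suc l)) / 2) ^ k :: complex"
  let ?F = "\<lambda>(u, v). ?h (u + v) * of_real (rho (Suc l) u * rho (Suc 0) v)"
  have F: "?F = (\<lambda>p. \<Sum>j\<le>k. of_nat (k choose j) * (case p of (u, v) \<Rightarrow> ?f j u * ?g (k - j) v))"
  proof (rule ext)
    fix p :: "real \<times> real"
    obtain u v where p: "p = (u, v)" by (cases p)
    \<comment> \<open>The shift splits between the two summands, so the binomial theorem separates u
      from v.\<close>
    have "\<i> * of_real (u + v) - of_nat (Suc (Suc l)) / 2
        = (\<i> * of_real u - of_nat (Suc l) / 2) + (\<i> * of_real v - 1 / 2 :: complex)"
      by (simp add: algebra_simps add_divide_distrib)
    then show "?F p = (\<Sum>j\<le>k. of_nat (k choose j) * (case p of (u, v) \<Rightarrow> ?f j u * ?g (k - j) v))"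
      by (simp only: p binomial_ring prod.case sum_distrib_left sum_distrib_right of_real_mult mult_ac)
  qed
  have intF: "integrable (lborel \<Otimes>\<^sub>M lborel) ?F"
    unfolding F by (intro Bochner_Integration.integrable_sum integrable_mult_right integrable_pair_mult f g)
  have "(\<integral>p. ?F p \<partial>(lborel \<Otimes>\<^sub>M lborel))
      = (\<Sum>j\<le>k. of_nat (k choose j) * (of_real (bernoulli_ho (Suc l) j) * of_real (bernoulli_ho 1 (k - j))))"
    unfolding F
    by (subst Bochner_Integration.integral_sum)
      (simp_all only: integral_mult_right_zero integrable_mult_right integrable_pair_mult[OF f(1) g(1)] f(2) g(2))
  also have "\<dots> = of_real (bernoulli_ho (Suc (Suc l)) k)"
    by (simp add: bernoulli_ho_Suc[of "Suc l"] mult.assoc)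
  finally show ?case
    using integral_convolution[OF meas _ intF] by simp
qed

section \<open>Expectations of Chebyshev polynomials and of the logarithm\<close>

lemma bernoulli_ho_0: "bernoulli_ho l 0 = 1"
proof (induction l)
  case 0
  show ?case by (simp add: bernoulli_ho_def)
next
  case (Suc l)
  have "fps_nth (fps_X / (fps_exp 1 - 1) * (fps_exp 1 - 1) :: real fps) 1 = 1"
    by (simp only: bernoulli_fps_mult) simp
  then have "bernoulli_ho 1 0 = 1"
    by (simp add: fps_mult_nth bernoulli_ho_def)
  then show ?case using Suc by (subst bernoulli_ho_Suc) simp
qed

lemma rho_even: "rho (Suc l) (- t) = rho (Suc l) t"
proof (induction l arbitrary: t)
  case 0
  show ?case by simp
next
  case (Suc l)
  have one: "rho (Suc 0) (- s) = rho (Suc 0) s" for s by simp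
  have "rho (Suc (Suc l)) (- t) = (LINT u|lborel. rho (Suc l) (- u) * rho (Suc 0) (- (t - u)))"
    by (simp only: rho.simps(3), subst lborel_integral_real_affine[where c = "-1" and t = 0])
      (simp_all del: rho.simps add: algebra_simps)
  also have "\<dots> = rho (Suc (Suc l)) t"
    by (simp only: Suc one rho.simps(3))
  finally show ?case .
qed

text \<open>By linearity each power of the umbra becomes its Bernoulli moment. The first part makes
  the remainder bound integrable; the second, through \<open>cheb_div\<close>, realises
  \<open>Bstar\<close> as an expectation.\<close>

lemma cheb_rho_integral:
  assumes "l \<ge> 1"
  shows "integrable lborel (\<lambda>u. cheb n (\<i> * of_real u - of_nat l / 2) * of_real (rho l u))"
    and "n \<ge> 1 \<Longrightarrow> has_bochner_integral lborel
      (\<lambda>u. cheb n (\<i> * of_real u - of_nat l / 2) / of_nat n * of_real (rho l u)) (of_real (Bstar l n))"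
proof -
  define b where "b u = \<i> * of_real u - of_nat l / 2" for u :: real
  have mom: "has_bochner_integral lborel (\<lambda>u. b u ^ k * of_real (rho l u)) (of_real (bernoulli_ho l k))" for k
    using assms rho_moments[of "l - 1" k] by (simp add: b_def)
  have poly: "has_bochner_integral lborel (\<lambda>u. (\<Sum>r\<le>n. c r * b u ^ r) * of_real (rho l u))
      (\<Sum>r\<le>n. c r * of_real (bernoulli_ho l r))" for c
    unfolding sum_distrib_right mult.assoc
    by (intro has_bochner_integral_sum has_bochner_integral_mult_right mom)
  show "integrable lborel (\<lambda>u. cheb n (b u) * of_real (rho l u))"
    using poly[of "\<lambda>r. of_nat (((n + r) choose (2 * r)) + ((n + r - 1) choose (2 * r))) / 2"]
    by (simp only: cheb_def has_bochner_integral_iff)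
  show "has_bochner_integral lborel (\<lambda>u. cheb n (b u) / of_nat n * of_real (rho l u)) (of_real (Bstar l n))"
    if "n \<ge> 1"
  proof -
    have "(\<Sum>r\<le>n. of_nat ((n + r) choose (2 * r)) / of_nat (n + r) * of_real (bernoulli_ho l r))
        = (of_real (Bstar l n) :: complex)"
      by (simp add: Bstar_def atLeast0AtMost)
    then show ?thesis
      using poly[of "\<lambda>r. of_nat ((n + r) choose (2 * r)) / of_nat (n + r)"]
      unfolding cheb_div[OF that] by simp
  qed
qed

text \<open>The mass is the zeroth moment. Since Re (iu - l/2)^2 = l^2/4 - u^2, the second moment
  yields integrability of u^2, which later dominates the logarithm.\<close>

lemma rho_integral:
  assumes "l \<ge> 1"
  shows "has_bochner_integral lborel (rho l) 1"
    and "integrable lborel (\<lambda>u. u\<^sup>2 * rho l u)"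
proof -
  have mom: "has_bochner_integral lborel (\<lambda>u. (\<i> * of_real u - of_nat l / 2) ^ k * of_real (rho l u))
      (of_real (bernoulli_ho l k))" for k
    using assms rho_moments[of "l - 1" k] by simp
  from has_bochner_integral_Re[OF mom[of 0]]
  show one: "has_bochner_integral lborel (rho l) 1" by (simp add: bernoulli_ho_0)
  then have [measurable]: "rho l \<in> borel_measurable borel"
    by (auto simp: has_bochner_integral_iff)
  have "integrable lborel (\<lambda>u. (\<i> * of_real u - of_nat l / 2) ^ 2 * of_real (rho l u))"
    using mom[of 2] by (simp only: has_bochner_integral_iff)
  then have "integrable lborel (\<lambda>u. Re ((\<i> * of_real u - of_nat l / 2) ^ 2 * of_real (rho l u)))"
    by (rule integrable_Re)
  then have "integrable lborel (\<lambda>u. (real l)\<^sup>2 / 4 * rho l u - Re ((\<i> * of_real u - of_nat l / 2) ^ 2 * of_real (rho l u)))"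
    using one by (intro Bochner_Integration.integrable_diff) (auto simp: has_bochner_integral_iff)
  then show "integrable lborel (\<lambda>u. u\<^sup>2 * rho l u)"
    by (simp add: power2_eq_square field_simps)
qed

text \<open>By evenness of \<open>rho l\<close>, the half-line integral of \<open>ln (1 + b u\<^sup>2)\<close> is half of the full one, and
  \<open>z\<^sup>2 y\<^sup>2 (1 + u\<^sup>2/y\<^sup>2)\<close> with \<open>y = x - l/2\<close> is the squared modulus of \<open>1 - (2 + B) z + z\<^sup>2\<close> for \<open>B = i u - l/2\<close>.\<close>

lemma FB_rhs_eq_integral:
  assumes l: "l \<ge> 1" and z: "0 < z" "z \<le> 1 / 4"
  shows "has_bochner_integral lborel
    (\<lambda>u. Re (- (1/2) * Ln (1 - (2 + (\<i> * of_real u - of_nat l / 2)) * of_real z + of_real z ^ 2)) * rho l u)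
    (FB_rhs l z)"
proof -
  define y where "y = z + 1 / z + real l / 2 - 2"
  define X where "X = 1 - (2 - real l / 2) * z + z\<^sup>2"
  have X: "X = z * y" using z by (simp add: X_def y_def algebra_simps power2_eq_square)
  \<comment> \<open>Here 1 - 2z >= 1/2 and the other terms are nonnegative. Positivity of X gives y
    > 0, which removes the absolute value in \<open>FB_rhs\<close>.\<close>
  have "X > 0"
  proof -
    have "real l / 2 * z \<ge> 0" "z\<^sup>2 \<ge> 0" using z by auto
    moreover have "X = 1 - 2 * z + real l / 2 * z + z\<^sup>2" by (simp add: X_def algebra_simps)
    ultimately show ?thesis using z by linarith
  qed
  then have y: "y > 0" using X z by (simp add: zero_less_mult_iff)
  define b where "b = 1 / y\<^sup>2"
  have b: "b > 0" using y by (simp add: b_def)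
  have rho: "integrable lborel (rho l)" "integral\<^sup>L lborel (rho l) = 1"
    using rho_integral(1)[OF l] by (auto simp: has_bochner_integral_iff)
  have [measurable]: "rho l \<in> borel_measurable borel"
    using rho(1) by auto
  have log_int: "integrable lborel (\<lambda>u. ln (1 + b * u\<^sup>2) * rho l u)"
  proof (rule Bochner_Integration.integrable_bound[OF integrable_mult_right[OF rho_integral(2)[OF l], of b]])
    show "AE u in lborel. norm (ln (1 + b * u\<^sup>2) * rho l u) \<le> norm (b * (u\<^sup>2 * rho l u))"
    proof (rule AE_I2)
      fix u :: real
      have "0 \<le> b * u\<^sup>2" using b by simp
      then have "0 \<le> ln (1 + b * u\<^sup>2)" "ln (1 + b * u\<^sup>2) \<le> b * u\<^sup>2"
        by (auto intro: ln_add_one_self_le_self)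
      then have "\<bar>ln (1 + b * u\<^sup>2)\<bar> * \<bar>rho l u\<bar> \<le> \<bar>b * u\<^sup>2\<bar> * \<bar>rho l u\<bar>"
        by (intro mult_right_mono) auto
      then show "norm (ln (1 + b * u\<^sup>2) * rho l u) \<le> norm (b * (u\<^sup>2 * rho l u))"
        by (simp add: abs_mult)
    qed
  qed measurable
  have half: "(LINT u|lborel. ln (1 + b * u\<^sup>2) * rho l u)
      = 2 * (LBINT u:{0..}. ln (1 + b * u\<^sup>2) * rho l u)"
  proof -
    have "has_bochner_integral lborel (\<lambda>u. indicator {0..} u *\<^sub>R (ln (1 + b * u\<^sup>2) * rho l u))
        (LBINT u:{0..}. ln (1 + b * u\<^sup>2) * rho l u)"
      unfolding set_lebesgue_integral_def
      by (intro has_bochner_integral_integrable integrable_mult_indicator log_int) auto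
    moreover have "rho l (- u) = rho l u" for u
      using l rho_even[of "l - 1" u] by (metis One_nat_def Suc_pred less_eq_Suc_le)
    ultimately have "has_bochner_integral lborel (\<lambda>u. ln (1 + b * u\<^sup>2) * rho l u)
        (2 *\<^sub>R (LBINT u:{0..}. ln (1 + b * u\<^sup>2) * rho l u))"
      by (intro has_bochner_integral_even_function) simp_all
    then show ?thesis
      by (simp only: has_bochner_integral_iff real_scaleR_def)
  qed
  \<comment> \<open>The logarithm of a squared modulus contributes the factor 1/4; folding the full
    line onto the half-line doubles it to the 1/2 in \<open>FB_rhs\<close>.\<close>
  have "has_bochner_integral lborel (\<lambda>u. - (1/2) * ln X * rho l u - 1/4 * (ln (1 + b * u\<^sup>2) * rho l u))
      (- (1/2) * ln X * 1 - 1/4 * (2 * (LBINT u:{0..}. ln (1 + b * u\<^sup>2) * rho l u)))"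
    unfolding half[symmetric]
    by (intro has_bochner_integral_diff has_bochner_integral_mult_right rho_integral(1) l
        has_bochner_integral_integrable log_int)
  moreover have "- (1/2) * ln X * 1 - 1/4 * (2 * (LBINT u:{0..}. ln (1 + b * u\<^sup>2) * rho l u)) = FB_rhs l z"
  proof -
    have x: "z + 1 / z + real l - 2 - real l / 2 = y" by (simp add: y_def)
    have "ln X = ln z + ln y" unfolding X using z y by (simp add: ln_mult)
    then show ?thesis
      unfolding FB_rhs_def Let_def x using y by (simp add: b_def algebra_simps)
  qed
  moreover have "- (1/2) * ln X * rho l u - 1/4 * (ln (1 + b * u\<^sup>2) * rho l u)
      = Re (- (1/2) * Ln (1 - (2 + (\<i> * of_real u - of_nat l / 2)) * of_real z + of_real z ^ 2)) * rho l u" for u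
  proof -
    define w where "w = 1 - (2 + (\<i> * of_real u - of_nat l / 2)) * of_real z + (of_real z :: complex) ^ 2"
    have w: "Re w = X" "Im w = - (u * z)"
      by (simp_all add: w_def X_def power2_eq_square)
    have "(cmod w)\<^sup>2 = X\<^sup>2 + (u * z)\<^sup>2" by (simp add: cmod_power2 w)
    also have "\<dots> = X\<^sup>2 * (1 + b * u\<^sup>2)"
      using y by (simp add: b_def X power_mult_distrib field_simps)
    finally have sq: "(cmod w)\<^sup>2 = X\<^sup>2 * (1 + b * u\<^sup>2)" .
    have w0: "w \<noteq> 0" using w \<open>X > 0\<close> by auto
    have "1 + b * u\<^sup>2 > 0" using b by (simp add: add_pos_nonneg)
    then have "2 * ln (cmod w) = 2 * ln X + ln (1 + b * u\<^sup>2)"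
      using arg_cong[OF sq, of ln] w0 \<open>X > 0\<close> by (simp add: ln_mult ln_realpow)
    then have "Re (- (1/2) * Ln w) = - (1/2) * ln X - 1/4 * ln (1 + b * u\<^sup>2)"
      using w0 by simp
    then show ?thesis
      unfolding w_def[symmetric] by (simp only: left_diff_distrib mult.assoc)
  qed
  ultimately show ?thesis by (simp only:)
qed

text \<open>Coefficients of an asymptotic expansion in powers of z are unique, so the estimates for
  all N together identify the formal series.\<close>

theorem theorem1p4:
  fixes l :: nat
  assumes "l \<ge> 1"
  shows "\<forall>N::nat. (\<lambda>z::real. FB_rhs l z - (\<Sum>n=1..N. Bstar l n * z ^ n))
            \<in> O[at_right 0](\<lambda>z. z ^ (N + 1))"
proof
  fix N :: nat
  define b where "b u = \<i> * of_real u - of_nat l / 2" for u :: real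
  \<comment> \<open>The weight sits inside the norms, so integrability follows from
    \<open>cheb_rho_integral\<close>, and the factor |rho l u| matches the pointwise bound.\<close>
  define K where "K u = 2 * (norm (cheb (Suc N) (b u) * of_real (rho l u)) + norm (cheb N (b u) * of_real (rho l u)))" for u
  have K: "integrable lborel K"
    unfolding K_def b_def
    by (intro integrable_mult_right Bochner_Integration.integrable_add integrable_norm cheb_rho_integral(1) assms)
  have bound: "\<bar>FB_rhs l z - (\<Sum>n=1..N. Bstar l n * z ^ n)\<bar> \<le> integral\<^sup>L lborel K * z ^ (N + 1)"
    if z: "0 < z" "z \<le> 1 / 4" for z
  proof -
    define L where "L u = - (1/2) * Ln (1 - (2 + b u) * of_real z + of_real z ^ 2)" for u
    define S where "S u = (\<Sum>n<N. cheb (Suc n) (b u) / of_nat (Suc n) * of_real z ^ Suc n)" for u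
    have S: "(\<Sum>n<N. of_real z ^ Suc n * (cheb (Suc n) (b u) / of_nat (Suc n) * of_real (rho l u)))
        = S u * of_real (rho l u)" for u
      unfolding S_def sum_distrib_right by (intro sum.cong) (simp_all add: mult_ac del: power_Suc of_nat_Suc)
    have "has_bochner_integral lborel
        (\<lambda>u. \<Sum>n<N. of_real z ^ Suc n * (cheb (Suc n) (b u) / of_nat (Suc n) * of_real (rho l u)))
        (of_real (\<Sum>n<N. z ^ Suc n * Bstar l (Suc n)))"
      unfolding b_def of_real_sum of_real_mult of_real_power
      by (intro has_bochner_integral_sum has_bochner_integral_mult_right cheb_rho_integral(2) assms) auto
    from has_bochner_integral_Re[OF this]
    have "has_bochner_integral lborel (\<lambda>u. Re (S u) * rho l u) (\<Sum>n<N. z ^ Suc n * Bstar l (Suc n))"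
      unfolding S by simp
    moreover have "(\<Sum>n<N. z ^ Suc n * Bstar l (Suc n)) = (\<Sum>n=1..N. Bstar l n * z ^ n)"
      by (rule sum.reindex_bij_witness[of _ "\<lambda>n. n - 1" Suc]) auto
    moreover have "has_bochner_integral lborel (\<lambda>u. Re (L u) * rho l u) (FB_rhs l z)"
      unfolding L_def b_def by (rule FB_rhs_eq_integral[OF assms z])
    ultimately have D: "has_bochner_integral lborel (\<lambda>u. Re (L u) * rho l u - Re (S u) * rho l u)
        (FB_rhs l z - (\<Sum>n=1..N. Bstar l n * z ^ n))"
      by (intro has_bochner_integral_diff) (simp_all only:)
    have le: "norm (Re (L u) * rho l u - Re (S u) * rho l u) \<le> K u * z ^ (N + 1)" for u
    proof -
      have "norm (L u - S u) \<le> 2 * (norm (cheb (Suc N) (b u)) + norm (cheb N (b u))) * z ^ Suc N"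
        unfolding L_def S_def
      proof (rule cheb_log_remainder)
        fix t :: real assume t: "0 \<le> t" "t \<le> z"
        have "Re (1 - (2 + b u) * of_real t + of_real t ^ 2) = 1 - 2 * t + real l / 2 * t + t\<^sup>2"
          by (simp add: b_def algebra_simps power2_eq_square)
        \<comment> \<open>This fixes the range z <= 1/4: there 1 - 2t >= 1/2 for every t in [0, z],
          uniformly in u because the real part does not involve u.\<close>
        also have "\<dots> \<ge> 1 / 2" using t z by (simp add: add_increasing2)
        finally show "Re (1 - (2 + b u) * of_real t + of_real t ^ 2) \<ge> 1 / 2" .
      qed (use z in auto)
      then have "\<bar>Re (L u - S u)\<bar> \<le> 2 * (norm (cheb (Suc N) (b u)) + norm (cheb N (b u))) * z ^ Suc N"
        using abs_Re_le_cmod order_trans by blast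
      then have "\<bar>Re (L u - S u)\<bar> * \<bar>rho l u\<bar>
          \<le> 2 * (norm (cheb (Suc N) (b u)) + norm (cheb N (b u))) * z ^ Suc N * \<bar>rho l u\<bar>"
        by (rule mult_right_mono) simp
      moreover have "norm (Re (L u) * rho l u - Re (S u) * rho l u) = \<bar>Re (L u - S u)\<bar> * \<bar>rho l u\<bar>"
        by (simp add: abs_mult flip: left_diff_distrib)
      moreover have "K u * z ^ (N + 1)
          = 2 * (norm (cheb (Suc N) (b u)) + norm (cheb N (b u))) * z ^ Suc N * \<bar>rho l u\<bar>"
        by (simp add: K_def norm_mult algebra_simps)
      ultimately show ?thesis by (simp only:)
    qed
    have "norm (LINT u|lborel. Re (L u) * rho l u - Re (S u) * rho l u) \<le> (LINT u|lborel. K u * z ^ (N + 1))"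
    proof (rule Bochner_Integration.integral_norm_bound_integral)
      show "integrable lborel (\<lambda>u. Re (L u) * rho l u - Re (S u) * rho l u)"
        using D by (simp only: has_bochner_integral_iff)
      show "integrable lborel (\<lambda>u. K u * z ^ (N + 1))"
        by (intro integrable_mult_left) (rule K)
    qed (rule le)
    then show ?thesis
      unfolding has_bochner_integral_integral_eq[OF D] by simp
  qed
  show "(\<lambda>z::real. FB_rhs l z - (\<Sum>n=1..N. Bstar l n * z ^ n)) \<in> O[at_right 0](\<lambda>z. z ^ (N + 1))"
  proof (rule bigoI)
    have "eventually (\<lambda>z. z \<in> {0<..<1/4::real}) (at_right 0)"
      by (rule eventually_at_right_real) simp
    then show "eventually (\<lambda>z. norm (FB_rhs l z - (\<Sum>n=1..N. Bstar l n * z ^ n))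
        \<le> integral\<^sup>L lborel K * norm (z ^ (N + 1))) (at_right 0)"
      by eventually_elim (use bound in auto)
  qed
qed

end
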